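(* Let $q$ be an odd prime power, and let $S_1$ and $S_2$ be two non-equivalent special spreads in $\mathrm{PG}(3,q)$ (with respect to the same symplectic polarity). Then the graphs $\Gamma_{q,S_1}$ and $\Gamma_{q,S_2}$ are not isomorphic.
   Context: A symplectic polarity $\zeta$ of $\mathrm{PG}(3,q)$ is a polarity with $x\in x^\zeta$ for every point $x$. The graph $Sp(4,q)$ has the points of $\mathrm{PG}(3,q)$ as vertices, two distinct points $x,y$ being adjacent iff $y\in x^\zeta$ (i.e. $x$ and $y$ are orthogonal). A line $L$ is totally isotropic if $L^\zeta=L$. A spread is a set of lines of $\mathrm{PG}(3,q)$ partitioning its point set. For $q$ odd, a special spread is a spread $S$ consisting of lines that are not totally isotropic such that for every $\ell\in S$ there is a uniquely determined line $\ell'\in S$ such that any point of $\ell$ is orthogonal to any point of $\ell'$ (that is, $\ell'=\ell^\zeta$). For paired lines $\ell,\ell'\in S$, the set $\ell\cup\ell'$ induces in $Sp(4,q)$ a complete bipartite graph $K_{q+1,q+1}$ with parts $\ell$ and $\ell'$; these sets $\ell\cup\ell'$ partition the vertex set of $Sp(4,q)$. The graph $\Gamma_{q,S}$ is the complement of the graph obtained from $Sp(4,q)$ by removing all the edges of each of these $K_{q+1,q+1}$'s. Two special spreads are equivalent if there exists an automorphism of the graph $Sp(4,q)$ mapping one of them to the other. *)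

theory Defs
  imports "HOL-Analysis.Cartesian_Space" "HOL-Library.Numeral_Type"
    "HOL-Library.Disjoint_Sets" "HOL-Number_Theory.Prime_Powers"
begin

text \<open>
  The projective space \<open>PG(3,q)\<close> is the subspace lattice of the four-dimensional vector space
  \<open>'a ^ 4\<close> over a field \<open>'a\<close> with \<open>q\<close> elements. All projective subspaces are represented by the
  corresponding linear subspaces, so incidence is inclusion, points have linear dimension 1 and
  lines have linear dimension 2.
\<close>

definition points :: "('a::field ^ 4) set set" where
  "points = {x. vec.subspace x \<and> vec.dim x = 1}"

definition lines :: "('a::field ^ 4) set set" where
  "lines = {l. vec.subspace l \<and> vec.dim l = 2}"

definition points_on :: "('a::field ^ 4) set \<Rightarrow> ('a ^ 4) set set" where
  "points_on U = {x \<in> points. x \<subseteq> U}"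

text \<open>
  A polarity is an inclusion-reversing map of order two on the lattice of subspaces. Its values on
  sets that are not subspaces are irrelevant. Being the identity is already excluded by
  the reversal of inclusions.
\<close>

definition polarity :: "(('a::field ^ 4) set \<Rightarrow> ('a ^ 4) set) \<Rightarrow> bool" where
  "polarity \<zeta> \<longleftrightarrow>
     (\<forall>U. vec.subspace U \<longrightarrow> vec.subspace (\<zeta> U) \<and> \<zeta> (\<zeta> U) = U) \<and>
     (\<forall>U W. vec.subspace U \<longrightarrow> vec.subspace W \<longrightarrow> U \<subseteq> W \<longrightarrow> \<zeta> W \<subseteq> \<zeta> U)"

definition symplectic_polarity :: "(('a::field ^ 4) set \<Rightarrow> ('a ^ 4) set) \<Rightarrow> bool" where
  "symplectic_polarity \<zeta> \<longleftrightarrow> polarity \<zeta> \<and> (\<forall>x\<in>points. x \<subseteq> \<zeta> x)"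

definition orthogonal_points ::
  "(('a::field ^ 4) set \<Rightarrow> ('a ^ 4) set) \<Rightarrow> ('a ^ 4) set \<Rightarrow> ('a ^ 4) set \<Rightarrow> bool" where
  "orthogonal_points \<zeta> x y \<longleftrightarrow> y \<subseteq> \<zeta> x"

definition totally_isotropic ::
  "(('a::field ^ 4) set \<Rightarrow> ('a ^ 4) set) \<Rightarrow> ('a ^ 4) set \<Rightarrow> bool" where
  "totally_isotropic \<zeta> l \<longleftrightarrow> \<zeta> l = l"

definition spread :: "('a::field ^ 4) set set \<Rightarrow> bool" where
  "spread S \<longleftrightarrow> S \<subseteq> lines \<and> partition_on points (points_on ` S)"

definition orthogonal_lines ::
  "(('a::field ^ 4) set \<Rightarrow> ('a ^ 4) set) \<Rightarrow> ('a ^ 4) set \<Rightarrow> ('a ^ 4) set \<Rightarrow> bool" where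
  "orthogonal_lines \<zeta> l m \<longleftrightarrow>
     (\<forall>x\<in>points_on l. \<forall>y\<in>points_on m. orthogonal_points \<zeta> x y)"

definition special_spread ::
  "(('a::field ^ 4) set \<Rightarrow> ('a ^ 4) set) \<Rightarrow> ('a ^ 4) set set \<Rightarrow> bool" where
  "special_spread \<zeta> S \<longleftrightarrow>
     spread S \<and> (\<forall>l\<in>S. \<not> totally_isotropic \<zeta> l) \<and>
     (\<forall>l\<in>S. \<exists>!m. m \<in> S \<and> orthogonal_lines \<zeta> l m)"

text \<open>Simple graphs: the edges are two-element sets of vertices.\<close>

record 'v sgraph =
  verts :: "'v set"
  edges :: "'v set set"

definition adj :: "'v sgraph \<Rightarrow> 'v \<Rightarrow> 'v \<Rightarrow> bool" where
  "adj G x y \<longleftrightarrow> {x, y} \<in> edges G"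

definition complement :: "'v sgraph \<Rightarrow> 'v sgraph" where
  "complement G =
     \<lparr>verts = verts G,
      edges = {{x, y} | x y. x \<in> verts G \<and> y \<in> verts G \<and> x \<noteq> y} - edges G\<rparr>"

definition induced_edges :: "'v sgraph \<Rightarrow> 'v set \<Rightarrow> 'v set set" where
  "induced_edges G A = {e \<in> edges G. e \<subseteq> A}"

definition delete_edges :: "'v sgraph \<Rightarrow> 'v set set \<Rightarrow> 'v sgraph" where
  "delete_edges G E = \<lparr>verts = verts G, edges = edges G - E\<rparr>"

definition graph_isomorphism :: "'v sgraph \<Rightarrow> 'w sgraph \<Rightarrow> ('v \<Rightarrow> 'w) \<Rightarrow> bool" where
  "graph_isomorphism G H f \<longleftrightarrow>
     bij_betw f (verts G) (verts H) \<and>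
     (\<forall>x\<in>verts G. \<forall>y\<in>verts G. adj G x y \<longleftrightarrow> adj H (f x) (f y))"

definition isomorphic :: "'v sgraph \<Rightarrow> 'w sgraph \<Rightarrow> bool" where
  "isomorphic G H \<longleftrightarrow> (\<exists>f. graph_isomorphism G H f)"

definition graph_automorphism :: "'v sgraph \<Rightarrow> ('v \<Rightarrow> 'v) \<Rightarrow> bool" where
  "graph_automorphism G f \<longleftrightarrow> graph_isomorphism G G f"

definition Sp_graph ::
  "(('a::field ^ 4) set \<Rightarrow> ('a ^ 4) set) \<Rightarrow> ('a ^ 4) set sgraph" where
  "Sp_graph \<zeta> =
     \<lparr>verts = points,
      edges = {{x, y} | x y. x \<in> points \<and> y \<in> points \<and> x \<noteq> y \<and> orthogonal_points \<zeta> x y}\<rparr>"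

text \<open>
  For a special spread, the edges induced on the points of \<open>l\<close> and \<open>m\<close>, for orthogonal lines
  \<open>l\<close> and \<open>m\<close> of the spread, are those of a complete bipartite graph with parts the points of \<open>l\<close>
  and the points of \<open>m\<close>.
\<close>

definition Gamma_graph ::
  "(('a::field ^ 4) set \<Rightarrow> ('a ^ 4) set) \<Rightarrow> ('a ^ 4) set set \<Rightarrow> ('a ^ 4) set sgraph" where
  "Gamma_graph \<zeta> S =
     complement (delete_edges (Sp_graph \<zeta>)
       (\<Union>{induced_edges (Sp_graph \<zeta>) (points_on l \<union> points_on m) | l m.
            l \<in> S \<and> m \<in> S \<and> orthogonal_lines \<zeta> l m}))"

text \<open>
  A graph automorphism acts on points only, so the lines of a spread are mapped as sets of points.
\<close>

definition equivalent_spreads ::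
  "(('a::field ^ 4) set \<Rightarrow> ('a ^ 4) set) \<Rightarrow> ('a ^ 4) set set \<Rightarrow> ('a ^ 4) set set \<Rightarrow> bool" where
  "equivalent_spreads \<zeta> S T \<longleftrightarrow>
     (\<exists>f. graph_automorphism (Sp_graph \<zeta>) f \<and>
          (\<lambda>l. f ` points_on l) ` S = points_on ` T)"

end

theory Submission
  imports Defs
begin

text \<open>
  Let \<open>H\<close> be the complement of \<open>\<Gamma>\<close>. In \<open>H\<close>, two points of one line of the spread are non-adjacent
  and have no common neighbour: all points orthogonal to both lie on the polar line, and those
  edges have been removed. Any other two non-adjacent points \<open>x\<close>, \<open>y\<close> have a common neighbour:
  the points orthogonal to both form the polar of the line \<open>xy\<close>, at most two of its points are
  excluded by the removed edges or by being \<open>x\<close> or \<open>y\<close>, and a line has at least three points.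
  So \<open>H\<close> determines the spread. Two distinct spread lines are paired iff no edge of \<open>H\<close> joins them, so
  \<open>H\<close> also determines the removed edges, hence \<open>Sp(4,q)\<close>, and an isomorphism of \<open>\<Gamma>\<close> graphs
  is an equivalence of spreads.
\<close>

section \<open>Points and lines\<close>

lemma dim_less_if_psubset:
  fixes U W :: "('a::field ^ 'n) set"
  assumes "vec.subspace U" "vec.subspace W" "U \<subset> W"
  shows "vec.dim U < vec.dim W"
  using assms vec.subspace_dim_equal[of U W] by (cases "vec.dim W \<le> vec.dim U") auto

text \<open>The intersection properly contains the point \<open>x\<close>, so it has dimension at
  least 2 and fills both lines.\<close>

lemma line_eq_if_two_points:
  assumes "l \<in> lines" "m \<in> lines" "x \<in> points" "y \<in> points" "x \<noteq> y"
    and "x \<subseteq> l" "y \<subseteq> l" "x \<subseteq> m" "y \<subseteq> m"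
  shows "l = m"
proof -
  have sub: "vec.subspace l" "vec.subspace m" "vec.dim l = 2" "vec.dim m = 2"
    "vec.subspace x" "vec.subspace y" "vec.dim x = 1" "vec.dim y = 1"
    using assms by (auto simp: lines_def points_def)
  have "\<not> l \<inter> m \<subseteq> x"
  proof
    assume "l \<inter> m \<subseteq> x"
    then have "y \<subseteq> x" using assms by blast
    then show False using sub assms vec.subspace_dim_equal[of y x] by simp
  qed
  then have "x \<subset> l \<inter> m" using assms by blast
  then have "vec.dim x < vec.dim (l \<inter> m)"
    using sub dim_less_if_psubset[of x "l \<inter> m"] vec.subspace_inter[of l m] by simp
  then have "2 \<le> vec.dim (l \<inter> m)" using sub by simp
  then have "l \<inter> m = k" if "k \<in> {l, m}" for k
    using that sub by (intro vec.subspace_dim_equal) (auto simp: vec.subspace_inter)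
  then show ?thesis by blast
qed

lemma span_point: "v \<noteq> 0 \<Longrightarrow> vec.span {v} \<in> points"
  by (simp add: points_def)

text \<open>Each nonzero vector spans a point. This turns pointwise orthogonality of lines into an
  inclusion of subspaces.\<close>

lemma subspace_subset_if_points_subset:
  assumes "vec.subspace l" "vec.subspace W" "\<And>x. x \<in> points_on l \<Longrightarrow> x \<subseteq> W"
  shows "l \<subseteq> W"
proof
  fix v assume v: "v \<in> l"
  show "v \<in> W"
  proof (cases "v = 0")
    case True then show ?thesis using assms vec.subspace_0 by blast
  next
    case False
    then have "vec.span {v} \<in> points_on l"
      using v assms(1) by (simp add: points_on_def span_point vec.span_minimal)
    then show ?thesis using assms(3) vec.span_base by blast
  qed
qed

lemma point_exists:
  assumes "vec.subspace l" "vec.dim l \<noteq> 0"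
  obtains x where "x \<in> points" "x \<subseteq> l"
proof -
  have "\<not> l \<subseteq> {0}" using assms vec.dim_eq_0[of l] by simp
  then obtain v where "v \<in> l" "v \<noteq> 0" by blast
  then show ?thesis using that[of "vec.span {v}"] assms
    by (simp add: span_point vec.span_minimal)
qed

text \<open>Distinct points meet in dimension 0, so the dimension formula gives 2. The span is kept
  in the conclusion because it is the least subspace containing both points: a polar containing them
  contains the line.\<close>

lemma line_exists:
  assumes "x \<in> points" "y \<in> points" "x \<noteq> y"
  obtains l where "l \<in> lines" "x \<subseteq> l" "y \<subseteq> l" "l = vec.span (x \<union> y)"
proof -
  have sub: "vec.subspace x" "vec.subspace y" "vec.dim x = 1" "vec.dim y = 1"
    using assms by (auto simp: points_def)
  have "\<not> x \<inter> y = x"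
    using assms sub vec.subspace_dim_equal[of x y] by auto
  then have "x \<inter> y \<subset> x" by blast
  then have "vec.dim (x \<inter> y) = 0"
    using sub dim_less_if_psubset[of "x \<inter> y" x] vec.subspace_inter[of x y]
    by (simp del: vec.dim_eq_0)
  moreover have "vec.span (x \<union> y) = {u + v |u v. u \<in> x \<and> v \<in> y}"
    using sub vec.span_Un[of x y] vec.span_eq_iff[of x] vec.span_eq_iff[of y]
    by (simp del: vec.span_eq_iff)
  ultimately have "vec.dim (vec.span (x \<union> y)) = 2"
    using vec.dim_sums_Int[of x y] sub by (simp del: vec.dim_eq_0 vec.dim_span)
  then show ?thesis
    using that[of "vec.span (x \<union> y)"] vec.span_superset[of "x \<union> y"]
    by (simp add: lines_def)
qed

text \<open>For a basis \<open>a\<close>, \<open>b\<close> of the line, the vectors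
  \<open>a\<close>, \<open>b\<close>, \<open>a + b\<close> span three distinct points, and
  \<open>p\<close>, \<open>r\<close> can exclude only two of them.\<close>

lemma third_point_on_line:
  assumes "l \<in> lines"
  obtains z where "z \<in> points" "z \<subseteq> l" "z \<noteq> p" "z \<noteq> r"
proof -
  have l: "vec.subspace l" "vec.dim l = 2" using assms by (auto simp: lines_def)
  obtain B where B: "B \<subseteq> l" "vec.independent B" "card B = 2"
    using vec.basis_exists[of l] l by metis
  then obtain a b where ab: "B = {a, b}" "a \<noteq> b" by (meson card_2_iff)
  have a: "a \<notin> vec.span {b}" and b: "b \<notin> vec.span {a}"
    using B ab vec.independent_insert[of a "{b}"] vec.independent_insert[of b "{a}"]
    by (auto simp: insert_commute)
  have nz: "a \<noteq> 0" "b \<noteq> 0" using a b vec.span_zero by auto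
  have c: "a + b \<notin> vec.span {a}" "a + b \<notin> vec.span {b}"
    using a b vec.span_add_eq[of a "{a}" b] vec.span_add_eq2[of b "{b}" a]
      vec.span_base[of a "{a}"] vec.span_base[of b "{b}"] by auto
  then have nz': "a + b \<noteq> 0" using vec.span_zero by metis
  have on: "a \<in> l" "b \<in> l" "a + b \<in> l" using B ab l vec.subspace_add by auto
  have P: "vec.span {a} \<in> points" "vec.span {b} \<in> points" "vec.span {a + b} \<in> points"
    using nz nz' span_point by auto
  have S: "vec.span {a} \<subseteq> l" "vec.span {b} \<subseteq> l" "vec.span {a + b} \<subseteq> l"
    using on l by (simp_all add: vec.span_minimal)
  have N: "vec.span {a} \<noteq> vec.span {b}" "vec.span {a} \<noteq> vec.span {a + b}"
    "vec.span {b} \<noteq> vec.span {a + b}"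
    using a c vec.span_base by (metis insertI1)+
  show ?thesis using P S N that by metis
qed

section \<open>Symplectic polarities\<close>

locale symplectic =
  fixes \<zeta> :: "('a::field ^ 4) set \<Rightarrow> ('a ^ 4) set"
  assumes sympl: "symplectic_polarity \<zeta>"
begin

lemma subspace_polar: "vec.subspace U \<Longrightarrow> vec.subspace (\<zeta> U)"
  and polar_polar: "vec.subspace U \<Longrightarrow> \<zeta> (\<zeta> U) = U"
  and polar_mono: "vec.subspace U \<Longrightarrow> vec.subspace W \<Longrightarrow> U \<subseteq> W \<Longrightarrow> \<zeta> W \<subseteq> \<zeta> U"
  and point_subset_polar: "x \<in> points \<Longrightarrow> x \<subseteq> \<zeta> x"
  using sympl unfolding symplectic_polarity_def polarity_def by simp_all

section \<open>Dimension of the polar subspace\<close>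

text \<open>An involution is injective, so strict inclusions stay strict when reversed.\<close>

lemma polar_dim_less:
  assumes "vec.subspace U" "vec.subspace W" "U \<subset> W"
  shows "vec.dim (\<zeta> W) < vec.dim (\<zeta> U)"
proof -
  have "\<zeta> W \<noteq> \<zeta> U" using assms polar_polar by (metis psubset_eq)
  then have "\<zeta> W \<subset> \<zeta> U" using assms polar_mono by blast
  then show ?thesis
    by (intro dim_less_if_psubset subspace_polar assms)
qed

text \<open>Climb from the zero space to \<open>U\<close> one dimension at a time: by strict
  reversal the polar, of dimension at most 4 at the start, loses at least one dimension per
  step.\<close>

lemma polar_dim_le: "vec.subspace U \<Longrightarrow> vec.dim (\<zeta> U) + vec.dim U \<le> 4"
proof (induction "vec.dim U" arbitrary: U)
  case 0
  then show ?case using dim_subset_UNIV_cart_gen[of "\<zeta> U"] by (simp del: vec.dim_eq_0)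
next
  case (Suc n)
  have "n \<le> vec.dim U" using Suc.hyps by simp
  then obtain T where T: "vec.subspace T" "T \<subseteq> vec.span U" "vec.dim T = n"
    by (rule vec.choose_subspace_of_subspace)
  have "vec.span U = U" using Suc.prems by simp
  then have "T \<subseteq> U" using T(2) by metis
  moreover have "T \<noteq> U" using T(3) Suc.hyps(2) by auto
  ultimately have "T \<subset> U" by blast
  then have "vec.dim (\<zeta> U) < vec.dim (\<zeta> T)" using polar_dim_less T Suc by blast
  then show ?case using Suc.hyps(1)[of T] Suc.hyps(2) T by simp
qed

text \<open>The same count above \<open>U\<close>: adjoining outside vectors until the whole space
  is reached costs the polar at least one dimension per step.\<close>

lemma polar_dim_ge: "vec.subspace U \<Longrightarrow> 4 \<le> vec.dim (\<zeta> U) + vec.dim U"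
proof (induction "4 - vec.dim U" arbitrary: U)
  case 0
  then show ?case by simp
next
  case (Suc n)
  have "U \<noteq> UNIV" using Suc.hyps(2) vec_dim_card[where 'a='a and 'n=4] by auto
  then obtain v where v: "v \<notin> U" by blast
  define W where "W = vec.span (insert v U)"
  have sU: "vec.span U = U" using Suc.prems by simp
  have W: "vec.subspace W" "vec.dim W = vec.dim U + 1"
    using v sU by (simp_all add: W_def vec.dim_insert del: vec.span_eq_iff)
  have "U \<subset> W" using v vec.span_superset[of "insert v U"] W_def by blast
  then have "vec.dim (\<zeta> W) < vec.dim (\<zeta> U)" using polar_dim_less W Suc by blast
  moreover have "n = 4 - vec.dim W" using Suc.hyps(2) W(2) by simp
  then have "4 \<le> vec.dim (\<zeta> W) + vec.dim W" using Suc.hyps(1) W(1) by blast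
  ultimately show ?case using W(2) by linarith
qed

lemma polar_dim: "vec.subspace U \<Longrightarrow> vec.dim (\<zeta> U) = 4 - vec.dim U"
  using polar_dim_le[of U] polar_dim_ge[of U] by simp

lemma polar_line: "l \<in> lines \<Longrightarrow> \<zeta> l \<in> lines"
  by (simp add: lines_def subspace_polar polar_dim)

lemma polar_sym:
  assumes "vec.subspace U" "vec.subspace W"
  shows "U \<subseteq> \<zeta> W \<longleftrightarrow> W \<subseteq> \<zeta> U"
  using assms polar_mono[of U "\<zeta> W"] polar_mono[of W "\<zeta> U"]
  by (auto simp: polar_polar subspace_polar)

text \<open>The polar of a point has dimension 3, and 3 + 2 exceeds 4, so it meets every
  line.\<close>

lemma point_meets_polar:
  assumes "x \<in> points" "l \<in> lines"
  obtains y where "y \<in> points" "y \<subseteq> l" "y \<subseteq> \<zeta> x"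
proof -
  have s: "vec.subspace x" "vec.subspace l" "vec.dim x = 1" "vec.dim l = 2"
    using assms by (auto simp: points_def lines_def)
  have "vec.dim {u + v |u v. u \<in> \<zeta> x \<and> v \<in> l} \<le> 4"
    using dim_subset_UNIV_cart_gen[where 'n=4] by simp
  then have "vec.dim (\<zeta> x \<inter> l) \<noteq> 0"
    using vec.dim_sums_Int[of "\<zeta> x" l] s subspace_polar[of x] polar_dim[of x] by linarith
  moreover have "vec.subspace (\<zeta> x \<inter> l)" using s subspace_polar vec.subspace_inter by blast
  ultimately obtain y where "y \<in> points" "y \<subseteq> \<zeta> x \<inter> l" by (metis point_exists)
  then show ?thesis using that by blast
qed

lemma orthogonal_lines_iff:
  assumes "l \<in> lines" "m \<in> lines"
  shows "orthogonal_lines \<zeta> l m \<longleftrightarrow> m = \<zeta> l"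
proof -
  have s: "vec.subspace l" "vec.subspace m" "vec.dim m = 2" "vec.dim (\<zeta> l) = 2"
    using assms polar_line[of l] by (auto simp: lines_def)
  show ?thesis
  proof
    assume o: "orthogonal_lines \<zeta> l m"
    \<comment> \<open>Points are collected into lines twice: first all points of \<open>l\<close>
      lie in \<open>\<zeta> x\<close>, which by symmetry puts \<open>x\<close> in
      \<open>\<zeta> l\<close>; then this is done for all points \<open>x\<close> of
      \<open>m\<close>. Equal dimensions finish.\<close>
    have "x \<subseteq> \<zeta> l" if x: "x \<in> points_on m" for x
    proof -
      have sx: "vec.subspace x" using x by (simp add: points_on_def points_def)
      have "y \<subseteq> \<zeta> x" if y: "y \<in> points_on l" for y
      proof -
        have "vec.subspace y" using y by (simp add: points_on_def points_def)
        moreover have "x \<subseteq> \<zeta> y" using o x y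
          by (simp add: orthogonal_lines_def orthogonal_points_def)
        ultimately show ?thesis using polar_sym sx by blast
      qed
      then have "l \<subseteq> \<zeta> x" by (rule subspace_subset_if_points_subset[OF s(1) subspace_polar[OF sx]])
      then show ?thesis using polar_sym s sx by blast
    qed
    then have "m \<subseteq> \<zeta> l" by (rule subspace_subset_if_points_subset[OF s(2) subspace_polar[OF s(1)]])
    then show "m = \<zeta> l"
      using s subspace_polar by (intro vec.subspace_dim_equal) simp_all
  next
    assume m: "m = \<zeta> l"
    show "orthogonal_lines \<zeta> l m"
      unfolding orthogonal_lines_def orthogonal_points_def
    proof (intro ballI)
      fix x y assume xy: "x \<in> points_on l" "y \<in> points_on m"
      then have "\<zeta> l \<subseteq> \<zeta> x" using s by (intro polar_mono) (auto simp: points_on_def points_def)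
      then show "y \<subseteq> \<zeta> x" using xy m by (auto simp: points_on_def)
    qed
  qed
qed

end

section \<open>Special spreads\<close>

locale special = symplectic \<zeta>
  for \<zeta> :: "('a::field ^ 4) set \<Rightarrow> ('a ^ 4) set" +
  fixes S :: "('a ^ 4) set set"
  assumes special: "special_spread \<zeta> S"
begin

lemma spread_line: "l \<in> S \<Longrightarrow> l \<in> lines"
  using special by (auto simp: special_spread_def spread_def)

lemma spread_cover:
  assumes "x \<in> points" obtains l where "l \<in> S" "x \<subseteq> l"
proof -
  have "x \<in> \<Union> (points_on ` S)"
    using special assms by (simp add: special_spread_def spread_def partition_on_def)
  then show ?thesis using that by (auto simp: points_on_def)
qed

lemma spread_unique:
  assumes "l \<in> S" "m \<in> S" "x \<in> points" "x \<subseteq> l" "x \<subseteq> m" shows "l = m"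
proof -
  have "disjoint (points_on ` S)"
    using special by (simp add: special_spread_def spread_def partition_on_def)
  moreover have "x \<in> points_on l \<inter> points_on m" using assms by (simp add: points_on_def)
  ultimately have eq: "points_on l = points_on m"
    using assms(1,2) by (auto simp: disjoint_def)
  \<comment> \<open>The partition only gives equality of point sets; a second common point makes the
    lines themselves equal.\<close>
  obtain y where y: "y \<in> points" "y \<subseteq> l" "y \<noteq> x"
    using third_point_on_line[OF spread_line[OF assms(1)], of x x] by metis
  then have "y \<subseteq> m" using eq by (auto simp: points_on_def)
  then show ?thesis using y assms spread_line line_eq_if_two_points by metis
qed

lemma polar_in_spread: assumes "l \<in> S" shows "\<zeta> l \<in> S"
proof -
  obtain m where "m \<in> S" "orthogonal_lines \<zeta> l m"
    using special assms by (auto simp: special_spread_def)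
  then show ?thesis using orthogonal_lines_iff spread_line assms by metis
qed

lemma polar_polar_line: "l \<in> S \<Longrightarrow> \<zeta> (\<zeta> l) = l"
  using spread_line polar_polar by (auto simp: lines_def)

lemma polar_neq: "l \<in> S \<Longrightarrow> \<zeta> l \<noteq> l"
  using special by (auto simp: special_spread_def totally_isotropic_def)

section \<open>Relations between points induced by a special spread\<close>

definition sameline :: "('a ^ 4) set \<Rightarrow> ('a ^ 4) set \<Rightarrow> bool" where
  "sameline x y \<longleftrightarrow> (\<exists>l\<in>S. x \<subseteq> l \<and> y \<subseteq> l)"

definition paired :: "('a ^ 4) set \<Rightarrow> ('a ^ 4) set \<Rightarrow> bool" where
  "paired x y \<longleftrightarrow> (\<exists>l\<in>S. x \<subseteq> l \<and> y \<subseteq> \<zeta> l)"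

text \<open>On points this is adjacency in the complement of \<open>Gamma_graph \<zeta> S\<close>,
  as \<open>adj_Gamma_iff\<close> confirms.\<close>

definition hadj :: "('a ^ 4) set \<Rightarrow> ('a ^ 4) set \<Rightarrow> bool" where
  "hadj x y \<longleftrightarrow> x \<noteq> y \<and> y \<subseteq> \<zeta> x \<and> \<not> sameline x y \<and> \<not> paired x y"

text \<open>\<open>l\<close> and \<open>\<zeta> l\<close> are different lines of the spread and so
  share no point, while every point of \<open>\<zeta> l\<close> is orthogonal to every point of
  \<open>l\<close>.\<close>

lemma paired_orthogonal:
  assumes "x \<in> points" "y \<in> points" "paired x y"
  shows "x \<noteq> y \<and> y \<subseteq> \<zeta> x \<and> \<not> sameline x y"
proof -
  obtain l where l: "l \<in> S" "x \<subseteq> l" "y \<subseteq> \<zeta> l" using assms by (auto simp: paired_def)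
  then have "\<zeta> l \<subseteq> \<zeta> x" using assms(1) spread_line[of l]
    by (intro polar_mono) (auto simp: points_def lines_def)
  moreover have "\<not> sameline x y"
    unfolding sameline_def
    using l assms spread_unique polar_in_spread polar_neq by metis
  moreover have "x \<noteq> y" using l assms spread_unique polar_in_spread polar_neq by metis
  ultimately show ?thesis using l by blast
qed

text \<open>Otherwise \<open>\<zeta> x\<close> contains both points and hence \<open>l\<close>, so
  \<open>x\<close> lies on \<open>\<zeta> l\<close> as well as on \<open>l\<close>, which are
  disjoint lines of the spread.\<close>

lemma sameline_not_orthogonal:
  assumes "x \<in> points" "y \<in> points" "x \<noteq> y" "sameline x y"
  shows "\<not> y \<subseteq> \<zeta> x"
proof
  assume y: "y \<subseteq> \<zeta> x"
  obtain l where l: "l \<in> S" "x \<subseteq> l" "y \<subseteq> l" using assms by (auto simp: sameline_def)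
  have s: "vec.subspace x" "vec.subspace y" "vec.subspace l"
    using assms l spread_line by (auto simp: points_def lines_def)
  obtain m where m: "m \<in> lines" "x \<subseteq> m" "y \<subseteq> m" "m = vec.span (x \<union> y)"
    using assms by (metis line_exists)
  then have lm: "l = vec.span (x \<union> y)"
    using line_eq_if_two_points[of l m x y] l assms spread_line by simp
  have "x \<union> y \<subseteq> \<zeta> x" using y point_subset_polar assms by blast
  then have "l \<subseteq> \<zeta> x" using lm vec.span_minimal s subspace_polar by metis
  then have "x \<subseteq> \<zeta> l" using polar_sym s by blast
  then show False using spread_unique polar_in_spread polar_neq l assms by metis
qed

lemma paired_sym: "paired x y \<Longrightarrow> paired y x"
  unfolding paired_def using polar_in_spread polar_polar_line by metis

lemma sameline_sym: "sameline x y \<Longrightarrow> sameline y x"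
  unfolding sameline_def by blast

lemma sameline_refl: "x \<in> points \<Longrightarrow> sameline x x"
  unfolding sameline_def using spread_cover by metis

lemma hadj_sym: "x \<in> points \<Longrightarrow> y \<in> points \<Longrightarrow> hadj x y \<Longrightarrow> hadj y x"
  unfolding hadj_def using polar_sym[of x y] paired_sym sameline_sym
  by (auto simp: points_def)

text \<open>Splits the edges of \<open>Sp_graph \<zeta>\<close> into kept and removed ones; the
  symplectic graph is rebuilt from this at the end.\<close>

lemma orthogonal_iff:
  assumes "x \<in> points" "y \<in> points"
  shows "x \<noteq> y \<and> y \<subseteq> \<zeta> x \<longleftrightarrow> hadj x y \<or> paired x y"
  using assms paired_orthogonal sameline_not_orthogonal hadj_def by blast

section \<open>Recovering the spread and its pairing from the graph\<close>

text \<open>The candidates are the points of \<open>\<zeta> k\<close>, where \<open>k\<close> joins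
  \<open>x\<close> and \<open>y\<close>. Those on the polars of the spread lines \<open>l\<close>
  through \<open>x\<close> and \<open>m\<close> through \<open>y\<close> must be avoided.\<close>

lemma common_neighbour:
  assumes xy: "x \<in> points" "y \<in> points" and ns: "\<not> sameline x y" and nh: "\<not> hadj x y"
  obtains z where "z \<in> points" "hadj x z" "hadj z y"
proof -
  have ne: "x \<noteq> y" using ns sameline_refl xy by auto
  obtain l m where l: "l \<in> S" "x \<subseteq> l" and m: "m \<in> S" "y \<subseteq> m" using xy spread_cover by metis
  have lm: "l \<noteq> m" using ns l m by (auto simp: sameline_def)
  obtain k where k: "k \<in> lines" "x \<subseteq> k" "y \<subseteq> k" "k = vec.span (x \<union> y)"
    using line_exists xy ne by metis
  have s: "vec.subspace x" "vec.subspace y" "vec.subspace k"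
    using xy k by (auto simp: points_def lines_def)
  have "\<zeta> k \<subseteq> \<zeta> x" "\<zeta> k \<subseteq> \<zeta> y" using polar_mono s k by blast+
  have kk: "\<zeta> (\<zeta> k) = k" using s polar_polar by blast
  \<comment> \<open>The removed edges at \<open>u\<close> go exactly to the points of
    \<open>\<zeta> n\<close>, where \<open>n\<close> is the spread line through
    \<open>u\<close>.\<close>
  have neighbour: "hadj u z"
    if u: "u \<in> points" "z \<in> points" "n \<in> S" "u \<subseteq> n" "z \<subseteq> \<zeta> u" "z \<noteq> u" "\<not> z \<subseteq> \<zeta> n" for u z n
  proof -
    have "\<not> paired u z" unfolding paired_def using u spread_unique by metis
    then show ?thesis unfolding hadj_def using u sameline_not_orthogonal by blast
  qed
  show ?thesis
  proof (cases "paired x y")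
    case True
    then have pm: "m = \<zeta> l" unfolding paired_def
      using l m xy spread_unique polar_in_spread by metis
    then have pl: "l = \<zeta> m" using polar_polar_line l by simp
    \<comment> \<open>Here \<open>x\<close> and \<open>y\<close> are orthogonal, so all points of
      \<open>k\<close> are orthogonal to both. Since \<open>k\<close> meets \<open>l\<close> only in
      \<open>x\<close> and \<open>m\<close> only in \<open>y\<close>, any third point of
      \<open>k\<close> avoids the two polars \<open>m\<close> and \<open>l\<close>.\<close>
    obtain z where z: "z \<in> points" "z \<subseteq> k" "z \<noteq> x" "z \<noteq> y"
      using third_point_on_line k by metis
    have yx: "y \<subseteq> \<zeta> x" using True paired_orthogonal xy by blast
    then have xy': "x \<subseteq> \<zeta> y" using polar_sym s by blast
    have "x \<union> y \<subseteq> \<zeta> x" "x \<union> y \<subseteq> \<zeta> y"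
      using yx xy' xy point_subset_polar by blast+
    then have "k \<subseteq> \<zeta> x" "k \<subseteq> \<zeta> y"
      using k(4) vec.span_minimal s subspace_polar by metis+
    moreover have "\<not> z \<subseteq> l"
    proof
      assume "z \<subseteq> l"
      then have "k = l" using line_eq_if_two_points[of k l x z] k l z xy spread_line by simp
      then show False using k ns l by (auto simp: sameline_def)
    qed
    moreover have "\<not> z \<subseteq> m"
    proof
      assume "z \<subseteq> m"
      then have "k = m" using line_eq_if_two_points[of k m y z] k m z xy spread_line by simp
      then show False using k ns m by (auto simp: sameline_def)
    qed
    ultimately have "z \<subseteq> \<zeta> x" "z \<subseteq> \<zeta> y" "\<not> z \<subseteq> \<zeta> l" "\<not> z \<subseteq> \<zeta> m"
      unfolding pm[symmetric] pl[symmetric] using z(2) by blast+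
    then have "hadj x z" "hadj y z"
      using neighbour[of x z l] neighbour[of y z m] l m z xy by blast+
    then show ?thesis using that z xy hadj_sym by blast
  next
    case False
    then have nyx: "\<not> y \<subseteq> \<zeta> x" using nh ns ne by (simp add: hadj_def)
    have K: "\<zeta> k \<in> lines" using k polar_line by blast
    \<comment> \<open>Two distinct lines share at most one point; \<open>p\<close> is that point, or
      arbitrary if there is none.\<close>
    have unique: "\<exists>p. \<forall>z. z \<in> points \<longrightarrow> z \<subseteq> \<zeta> k \<longrightarrow> z \<subseteq> \<zeta> n \<longrightarrow> z = p"
      if n: "n \<in> S" "n \<noteq> k" for n
    proof -
      have "\<zeta> k \<noteq> \<zeta> n" using n kk polar_polar_line by metis
      then show ?thesis
        using line_eq_if_two_points[OF K polar_line[OF spread_line[OF n(1)]]] by metis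
    qed
    have "l \<noteq> k" "m \<noteq> k" using k ns l m by (auto simp: sameline_def)
    then obtain p r where
      p: "\<And>z. z \<in> points \<Longrightarrow> z \<subseteq> \<zeta> k \<Longrightarrow> z \<subseteq> \<zeta> l \<Longrightarrow> z = p" and
      r: "\<And>z. z \<in> points \<Longrightarrow> z \<subseteq> \<zeta> k \<Longrightarrow> z \<subseteq> \<zeta> m \<Longrightarrow> z = r"
      using unique l m by metis
    obtain z where z: "z \<in> points" "z \<subseteq> \<zeta> k" "z \<noteq> p" "z \<noteq> r"
      using third_point_on_line K by metis
    have zx: "z \<subseteq> \<zeta> x" "z \<subseteq> \<zeta> y" using z \<open>\<zeta> k \<subseteq> \<zeta> x\<close> \<open>\<zeta> k \<subseteq> \<zeta> y\<close> by auto
    \<comment> \<open>As \<open>x\<close> and \<open>y\<close> are not orthogonal, neither lies on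
      \<open>\<zeta> k\<close>, so only \<open>p\<close> and \<open>r\<close> had to be
      avoided.\<close>
    have "z \<noteq> x" "z \<noteq> y" using zx nyx polar_sym s by auto
    then have "hadj x z" "hadj y z"
      using neighbour[of x z l] neighbour[of y z m] l m z xy zx p r by blast+
    then show ?thesis using that z xy hadj_sym by blast
  qed
qed

text \<open>A point orthogonal to two points of \<open>l\<close> is orthogonal to all of
  \<open>l\<close>, so it lies on \<open>\<zeta> l\<close>, and its edges to \<open>l\<close> were
  removed.\<close>

lemma no_common_neighbour:
  assumes "x \<in> points" "y \<in> points" "z \<in> points" "x \<noteq> y" "sameline x y"
  shows "\<not> (hadj x z \<and> hadj z y)"
proof
  assume h: "hadj x z \<and> hadj z y"
  obtain l where l: "l \<in> S" "x \<subseteq> l" "y \<subseteq> l" using assms by (auto simp: sameline_def)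
  obtain k where k: "k \<in> lines" "x \<subseteq> k" "y \<subseteq> k" "k = vec.span (x \<union> y)"
    using assms line_exists by metis
  then have lk: "l = k" using line_eq_if_two_points[of l k x y] l assms spread_line by simp
  have s: "vec.subspace z" "vec.subspace x" "vec.subspace l"
    using assms l spread_line by (auto simp: points_def lines_def)
  have "x \<subseteq> \<zeta> z" "y \<subseteq> \<zeta> z" using h polar_sym s by (auto simp: hadj_def)
  then have "l \<subseteq> \<zeta> z" using lk k(4) vec.span_minimal[of "x \<union> y" "\<zeta> z"] subspace_polar s by simp
  then have "z \<subseteq> \<zeta> l" using polar_sym s by blast
  then have "paired x z" using l by (auto simp: paired_def)
  then show False using h by (simp add: hadj_def)
qed

text \<open>The right side mentions only \<open>hadj\<close>, so isomorphisms preserve it. Equality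
  is a separate case because every neighbour of \<open>x\<close> is a common neighbour of
  \<open>x\<close> and \<open>x\<close>.\<close>

lemma sameline_iff:
  assumes "x \<in> points" "y \<in> points"
  shows "sameline x y \<longleftrightarrow>
    x = y \<or> \<not> hadj x y \<and> \<not> (\<exists>z\<in>points. hadj x z \<and> hadj z y)"
  using assms no_common_neighbour common_neighbour sameline_refl hadj_def by metis

text \<open>Again the right side is preserved by isomorphisms. If the spread lines \<open>l\<close>,
  \<open>m\<close> through \<open>x\<close>, \<open>y\<close> are distinct and not polar, the plane
  \<open>\<zeta> x\<close> meets \<open>m\<close> in a point \<open>v\<close>, and the edge from
  \<open>x\<close> to \<open>v\<close> survives; between polar lines all edges are removed.\<close>

lemma paired_iff:
  assumes "x \<in> points" "y \<in> points"
  shows "paired x y \<longleftrightarrow> \<not> sameline x y \<and>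
    \<not> (\<exists>u\<in>points. \<exists>v\<in>points. sameline x u \<and> sameline y v \<and> hadj u v)"
proof -
  obtain l m where l: "l \<in> S" "x \<subseteq> l" and m: "m \<in> S" "y \<subseteq> m"
    using assms spread_cover by metis
  have x: "sameline x u \<longleftrightarrow> u \<subseteq> l" for u
    using l assms spread_unique unfolding sameline_def by metis
  have y: "sameline y u \<longleftrightarrow> u \<subseteq> m" for u
    using m assms spread_unique unfolding sameline_def by metis
  have p: "paired u v \<longleftrightarrow> m = \<zeta> l" if "u \<in> points" "v \<in> points" "u \<subseteq> l" "v \<subseteq> m" for u v
    using that l m spread_unique polar_in_spread unfolding paired_def by metis
  have "\<exists>u\<in>points. \<exists>v\<in>points. u \<subseteq> l \<and> v \<subseteq> m \<and> hadj u v"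
    if ne: "m \<noteq> \<zeta> l" "\<not> sameline x y"
  proof -
    obtain v where v: "v \<in> points" "v \<subseteq> m" "v \<subseteq> \<zeta> x"
      using point_meets_polar[of x m] assms m spread_line by metis
    then have "\<not> sameline x v" using ne x y m spread_unique l by (metis sameline_def)
    moreover then have "x \<noteq> v" using sameline_refl assms by auto
    moreover have "\<not> paired x v" using p[of x v] v assms l ne by simp
    ultimately have "hadj x v" using v by (simp add: hadj_def)
    then show ?thesis using v l assms by blast
  qed
  moreover have "\<not> hadj u v" if "m = \<zeta> l" "u \<in> points" "v \<in> points" "u \<subseteq> l" "v \<subseteq> m" for u v
    using p[of u v] that by (simp add: hadj_def)
  moreover have "paired x y \<longleftrightarrow> m = \<zeta> l" using p[of x y] assms l m by blast
  ultimately show ?thesis unfolding x y using paired_orthogonal assms x by blast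
qed

section \<open>Adjacency in the graphs and the spread as a set of classes\<close>

lemma adj_Sp_iff:
  "adj (Sp_graph \<zeta>) x y \<longleftrightarrow> x \<in> points \<and> y \<in> points \<and> x \<noteq> y \<and> y \<subseteq> \<zeta> x"
  using polar_sym[of x y]
  by (auto simp: adj_def Sp_graph_def orthogonal_points_def doubleton_eq_iff points_def)

lemma adj_Gamma_iff:
  "adj (Gamma_graph \<zeta> S) x y \<longleftrightarrow> x \<in> points \<and> y \<in> points \<and> x \<noteq> y \<and> \<not> hadj x y"
proof -
  define D where "D = (\<Union>{induced_edges (Sp_graph \<zeta>) (points_on l \<union> points_on m) | l m.
            l \<in> S \<and> m \<in> S \<and> orthogonal_lines \<zeta> l m})"
  have D: "{x, y} \<in> D \<longleftrightarrow> adj (Sp_graph \<zeta>) x y \<and> (sameline x y \<or> paired x y)"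
    if xy: "x \<in> points" "y \<in> points"
  proof -
    have "{x, y} \<in> D \<longleftrightarrow> adj (Sp_graph \<zeta>) x y \<and>
      (\<exists>l m. l \<in> S \<and> m \<in> S \<and> orthogonal_lines \<zeta> l m \<and> {x, y} \<subseteq> points_on l \<union> points_on m)"
      unfolding D_def induced_edges_def adj_def by auto
    \<comment> \<open>Orthogonality forces \<open>m\<close> to be \<open>\<zeta> l\<close>, leaving
      a single quantifier.\<close>
    also have "(\<exists>l m. l \<in> S \<and> m \<in> S \<and> orthogonal_lines \<zeta> l m \<and>
        {x, y} \<subseteq> points_on l \<union> points_on m) \<longleftrightarrow>
      (\<exists>l\<in>S. (x \<subseteq> l \<or> x \<subseteq> \<zeta> l) \<and> (y \<subseteq> l \<or> y \<subseteq> \<zeta> l))"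
      using orthogonal_lines_iff spread_line polar_in_spread xy
      by (auto simp: points_on_def) metis+
    \<comment> \<open>Exchanging \<open>l\<close> with \<open>\<zeta> l\<close> reduces the four
      cases to two.\<close>
    also have "\<dots> \<longleftrightarrow> sameline x y \<or> paired x y"
      unfolding sameline_def paired_def using polar_in_spread polar_polar_line by metis
    finally show ?thesis .
  qed
  have "adj (Gamma_graph \<zeta> S) x y \<longleftrightarrow>
    x \<in> points \<and> y \<in> points \<and> x \<noteq> y \<and> \<not> (adj (Sp_graph \<zeta>) x y \<and> {x, y} \<notin> D)"
    unfolding Gamma_graph_def D_def[symmetric]
    by (auto simp: adj_def complement_def delete_edges_def doubleton_eq_iff Sp_graph_def)
  also have "\<dots> \<longleftrightarrow> x \<in> points \<and> y \<in> points \<and> x \<noteq> y \<and> \<not> hadj x y"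
    using D by (auto simp: adj_Sp_iff hadj_def)
  finally show ?thesis .
qed

lemma verts_Gamma: "verts (Gamma_graph \<zeta> S) = points"
  by (simp add: Gamma_graph_def complement_def delete_edges_def Sp_graph_def)

lemma sameline_class:
  assumes "l \<in> S" "x \<in> points" "x \<subseteq> l"
  shows "points_on l = {y \<in> points. sameline x y}"
  using assms spread_unique unfolding sameline_def points_on_def by blast

text \<open>Describes the spread by \<open>sameline\<close> alone, the form in which a map of points
  can carry it over.\<close>

lemma spread_classes: "points_on ` S = (\<lambda>x. {y \<in> points. sameline x y}) ` points"
proof (intro equalityI image_subsetI)
  fix l assume l: "l \<in> S"
  then obtain x where "x \<in> points" "x \<subseteq> l" using third_point_on_line spread_line by metis
  then show "points_on l \<in> (\<lambda>x. {y \<in> points. sameline x y}) ` points"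
    using l sameline_class by blast
next
  fix x :: "('a ^ 4) set" assume x: "x \<in> points"
  then obtain l where l: "l \<in> S" "x \<subseteq> l" by (rule spread_cover)
  then show "{y \<in> points. sameline x y} \<in> points_on ` S"
    using sameline_class[OF l(1) x l(2)] by (metis imageI)
qed

end

section \<open>Transport along an isomorphism\<close>

text \<open>The isomorphism \<open>f\<close> itself is the equivalence: it preserves
  \<open>hadj\<close>, therefore \<open>sameline\<close>, therefore \<open>paired\<close>, and with
  these both orthogonality and the spread classes.\<close>

lemma equivalent_if_isomorphic:
  assumes "symplectic_polarity \<zeta>" "special_spread \<zeta> S" "special_spread \<zeta> T"
    and "isomorphic (Gamma_graph \<zeta> S) (Gamma_graph \<zeta> T)"
  shows "equivalent_spreads \<zeta> S T"
proof -
  interpret A: special \<zeta> S using assms by unfold_locales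
  interpret B: special \<zeta> T using assms by unfold_locales
  obtain f where f: "graph_isomorphism (Gamma_graph \<zeta> S) (Gamma_graph \<zeta> T) f"
    using assms by (auto simp: isomorphic_def)
  then have bij: "bij_betw f points points"
    by (simp add: graph_isomorphism_def A.verts_Gamma B.verts_Gamma)
  then have im: "f ` points = points" and fp: "\<And>x. x \<in> points \<Longrightarrow> f x \<in> points"
    by (auto simp: bij_betw_def)
  have inj: "f x = f y \<longleftrightarrow> x = y" if "x \<in> points" "y \<in> points" for x y
    using bij that by (auto simp: bij_betw_def inj_on_def)
  have h: "B.hadj (f x) (f y) \<longleftrightarrow> A.hadj x y" if "x \<in> points" "y \<in> points" for x y
  proof -
    have "adj (Gamma_graph \<zeta> S) x y \<longleftrightarrow> adj (Gamma_graph \<zeta> T) (f x) (f y)"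
      using f that by (simp add: graph_isomorphism_def A.verts_Gamma)
    then show ?thesis
      using that fp inj A.adj_Gamma_iff B.adj_Gamma_iff A.hadj_def B.hadj_def by metis
  qed
  \<comment> \<open>Since \<open>f\<close> is onto, witnesses for \<open>T\<close> may be taken of
    the form \<open>f z\<close>, which aligns the characterisations for the two spreads.\<close>
  have ex: "(\<exists>z\<in>points. P z) \<longleftrightarrow> (\<exists>z\<in>points. P (f z))" for P
    using im by (metis image_iff)
  have s: "B.sameline (f x) (f y) \<longleftrightarrow> A.sameline x y" if "x \<in> points" "y \<in> points" for x y
    using that fp
    by (simp add: A.sameline_iff B.sameline_iff inj h ex[of "\<lambda>z. B.hadj (f x) z \<and> B.hadj z (f y)"]
        cong: bex_cong)
  have p: "B.paired (f x) (f y) \<longleftrightarrow> A.paired x y" if "x \<in> points" "y \<in> points" for x y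
  proof -
    have "(\<exists>u\<in>points. \<exists>v\<in>points. B.sameline (f x) u \<and> B.sameline (f y) v \<and> B.hadj u v) \<longleftrightarrow>
      (\<exists>u\<in>points. \<exists>v\<in>points. B.sameline (f x) (f u) \<and> B.sameline (f y) (f v) \<and> B.hadj (f u) (f v))"
      by (subst ex, rule bex_cong[OF refl], rule ex)
    also have "\<dots> \<longleftrightarrow>
      (\<exists>u\<in>points. \<exists>v\<in>points. A.sameline x u \<and> A.sameline y v \<and> A.hadj u v)"
      using that by (simp add: s h cong: bex_cong)
    finally show ?thesis
      using that fp by (simp only: A.paired_iff B.paired_iff s)
  qed
  have "adj (Sp_graph \<zeta>) x y \<longleftrightarrow> adj (Sp_graph \<zeta>) (f x) (f y)"
    if "x \<in> points" "y \<in> points" for x y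
    using that fp h p A.orthogonal_iff[of x y] B.orthogonal_iff[of "f x" "f y"]
    by (simp add: A.adj_Sp_iff)
  then have "graph_automorphism (Sp_graph \<zeta>) f"
    using bij by (simp add: graph_automorphism_def graph_isomorphism_def Sp_graph_def)
  moreover have "(\<lambda>l. f ` points_on l) ` S = points_on ` T"
  proof -
    have "f ` {y \<in> points. A.sameline x y} = {y \<in> points. B.sameline (f x) y}"
      if "x \<in> points" for x
    proof -
      have "{y \<in> f ` points. B.sameline (f x) y} = f ` {y \<in> points. A.sameline x y}"
        using that s by blast
      then show ?thesis using im by simp
    qed
    then have "(\<lambda>C. f ` C) ` points_on ` S = (\<lambda>x. {y \<in> points. B.sameline (f x) y}) ` points"
      unfolding A.spread_classes image_image by (rule image_cong[OF refl])
    \<comment> \<open>Surjectivity of \<open>f\<close> again: every class for \<open>T\<close> is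
      the class of some \<open>f x\<close>.\<close>
    also have "\<dots> = points_on ` T"
      unfolding B.spread_classes by (subst (2) im[symmetric]) (simp only: image_image)
    finally show ?thesis by (simp only: image_image)
  qed
  ultimately show ?thesis unfolding equivalent_spreads_def by blast
qed

theorem theorem5:
  fixes \<zeta> :: "('a::{field,finite} ^ 4) set \<Rightarrow> ('a ^ 4) set"
    and S\<^sub>1 S\<^sub>2 :: "('a ^ 4) set set"
    and q :: nat
  assumes "primepow q" and "odd q" and "CARD('a) = q"
    and "symplectic_polarity \<zeta>"
    and "special_spread \<zeta> S\<^sub>1" and "special_spread \<zeta> S\<^sub>2"
    and "\<not> equivalent_spreads \<zeta> S\<^sub>1 S\<^sub>2"
  shows "\<not> isomorphic (Gamma_graph \<zeta> S\<^sub>1) (Gamma_graph \<zeta> S\<^sub>2)"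
  using equivalent_if_isomorphic assms by blast

end
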